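(* Let $n\ge m\ge l$ be positive integers. Assume that $A\in\mathbb{R}^{n\times n}$ and $D\in\mathbb{R}^{l\times l}$ are nonsingular matrices whose symmetric parts $A_H=\frac{A+A^T}{2}$ and $D_H=\frac{D+D^T}{2}$ are positive definite, and that $B\in\mathbb{R}^{m\times n}$ and $C\in\mathbb{R}^{l\times m}$ have full row rank. Let $\alpha,\beta,\tau,\omega>0$ and let $P\in\mathbb{R}^{n\times n}$, $Q\in\mathbb{R}^{l\times l}$, $R\in\mathbb{R}^{m\times m}$ be symmetric positive definite. Let $\mathcal{B}$ and $\Theta$ be the block matrices $$\mathcal{B}=\begin{bmatrix}A&0&B^T\\0&D&C\\-B&-C^T&0\end{bmatrix},\qquad \Theta=\begin{bmatrix}\alpha P&0&0\\0&\beta Q&0\\0&0&\tau R\end{bmatrix},$$ and put $\widetilde{\Theta}=\frac{\Theta^{-1}\mathcal{B}+\mathcal{B}^T\Theta^{-1}}{2}$. If $$\omega\ \ge\ \max\left\{\frac12-\frac{\lambda_{\min}(\widetilde{\Theta})}{\vartheta(\Theta^{-1}\mathcal{B})^2},\,0\right\},$$ then, for every $b\in\mathbb{R}^{n+l+m}$, the GSS iterative method converges (for every initial vector) to the unique solution of the linear system $\mathcal{B}u=b$.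
   Context: $\vartheta(X)$ denotes the spectral radius of a square matrix $X$, and $\lambda_{\min}(X)$ the smallest eigenvalue of a matrix $X$ with real eigenvalues. The GSS (generalized shift-splitting) iterative method for $\mathcal{B}u=b$ is based on the splitting $\mathcal{B}=\mathcal{P}_{\mathrm{GSS}}-\mathcal{N}_{\mathrm{GSS}}$ with $\mathcal{P}_{\mathrm{GSS}}=\Theta+\omega\mathcal{B}$ and $\mathcal{N}_{\mathrm{GSS}}=\Theta-(1-\omega)\mathcal{B}$: starting from an initial vector $u^{(0)}\in\mathbb{R}^{n+l+m}$ it computes $u^{(k+1)}=\mathcal{G}u^{(k)}+d$ for $k=0,1,2,\dots$, where $\mathcal{G}=\mathcal{P}_{\mathrm{GSS}}^{-1}\mathcal{N}_{\mathrm{GSS}}$ and $d=\mathcal{P}_{\mathrm{GSS}}^{-1}b$. *)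

theory Defs
  imports "HOL-Analysis.Analysis"
begin

text \<open>A real matrix with \<open>m\<close> rows and \<open>n\<close> columns has type \<open>real^'n^'m\<close>, where
  \<open>CARD('m) = m\<close> and \<open>CARD('n) = n\<close>.\<close>

definition sympart :: "real^'n^'n \<Rightarrow> real^'n^'n" where
  "sympart X = (1/2) *\<^sub>R (X + transpose X)"

definition spd :: "real^'n^'n \<Rightarrow> bool" where
  "spd X \<longleftrightarrow> transpose X = X \<and> (\<forall>x. x \<noteq> 0 \<longrightarrow> x \<bullet> (X *v x) > 0)"

definition is_eigenvalue :: "'a::field^'n^'n \<Rightarrow> 'a \<Rightarrow> bool" where
  "is_eigenvalue X c \<longleftrightarrow> (\<exists>v. v \<noteq> 0 \<and> X *v v = c *s v)"

text \<open>The spectral radius ranges over the complex eigenvalues of the real matrix.\<close>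

definition spectral_radius :: "real^'n^'n \<Rightarrow> real" where
  "spectral_radius X = Max (cmod ` {c. is_eigenvalue (map_matrix complex_of_real X) c})"

text \<open>Only meaningful for matrices all of whose eigenvalues are real, e.g. symmetric ones.\<close>

definition lambda_min :: "real^'n^'n \<Rightarrow> real" where
  "lambda_min X = Min {c. is_eigenvalue X c}"

text \<open>The direct sum \<open>\<real>\<^sup>n \<oplus> \<real>\<^sup>l \<oplus> \<real>\<^sup>m\<close> is indexed by the sum type \<open>'n + 'l + 'm\<close>.\<close>

definition block_matrix3 ::
  "'a^'n^'n \<Rightarrow> 'a^'l^'n \<Rightarrow> 'a^'m^'n \<Rightarrow>
   'a^'n^'l \<Rightarrow> 'a^'l^'l \<Rightarrow> 'a^'m^'l \<Rightarrow>
   'a^'n^'m \<Rightarrow> 'a^'l^'m \<Rightarrow> 'a^'m^'m \<Rightarrow> 'a^('n + 'l + 'm)^('n + 'l + 'm)" where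
  "block_matrix3 X11 X12 X13 X21 X22 X23 X31 X32 X33 = (\<chi> i j.
     (case i of
        Inl p \<Rightarrow> (case j of Inl q \<Rightarrow> X11 $ p $ q | Inr (Inl q) \<Rightarrow> X12 $ p $ q | Inr (Inr q) \<Rightarrow> X13 $ p $ q)
      | Inr (Inl p) \<Rightarrow> (case j of Inl q \<Rightarrow> X21 $ p $ q | Inr (Inl q) \<Rightarrow> X22 $ p $ q | Inr (Inr q) \<Rightarrow> X23 $ p $ q)
      | Inr (Inr p) \<Rightarrow> (case j of Inl q \<Rightarrow> X31 $ p $ q | Inr (Inl q) \<Rightarrow> X32 $ p $ q | Inr (Inr q) \<Rightarrow> X33 $ p $ q)))"

definition saddle_matrix ::
  "real^'n^'n \<Rightarrow> real^'n^'m \<Rightarrow> real^'m^'l \<Rightarrow> real^'l^'l \<Rightarrow> real^('n + 'l + 'm)^('n + 'l + 'm)" where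
  "saddle_matrix A B C D = block_matrix3
      A       0                (transpose B)
      0       D                C
      (- B)   (- transpose C)  0"

definition Theta_matrix ::
  "real \<Rightarrow> real \<Rightarrow> real \<Rightarrow> real^'n^'n \<Rightarrow> real^'l^'l \<Rightarrow> real^'m^'m \<Rightarrow> real^('n + 'l + 'm)^('n + 'l + 'm)" where
  "Theta_matrix \<alpha> \<beta> \<tau> P Q R = block_matrix3
      (\<alpha> *\<^sub>R P)  0           0
      0           (\<beta> *\<^sub>R Q)  0
      0           0           (\<tau> *\<^sub>R R)"

definition Theta_tilde :: "real^'k^'k \<Rightarrow> real^'k^'k \<Rightarrow> real^'k^'k" where
  "Theta_tilde \<Theta> \<B> = (1/2) *\<^sub>R (matrix_inv \<Theta> ** \<B> + transpose \<B> ** matrix_inv \<Theta>)"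

definition P_GSS :: "real \<Rightarrow> real^'k^'k \<Rightarrow> real^'k^'k \<Rightarrow> real^'k^'k" where
  "P_GSS \<omega> \<Theta> \<B> = \<Theta> + \<omega> *\<^sub>R \<B>"

definition N_GSS :: "real \<Rightarrow> real^'k^'k \<Rightarrow> real^'k^'k \<Rightarrow> real^'k^'k" where
  "N_GSS \<omega> \<Theta> \<B> = \<Theta> - (1 - \<omega>) *\<^sub>R \<B>"

definition G_GSS :: "real \<Rightarrow> real^'k^'k \<Rightarrow> real^'k^'k \<Rightarrow> real^'k^'k" where
  "G_GSS \<omega> \<Theta> \<B> = matrix_inv (P_GSS \<omega> \<Theta> \<B>) ** N_GSS \<omega> \<Theta> \<B>"

text \<open>Since \<open>matrix_inv\<close> is an unspecified matrix on singular arguments, the iteration is the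
  intended one only if \<open>P_GSS \<omega> \<Theta> \<B>\<close> is invertible.\<close>

primrec gss_iterate ::
  "real \<Rightarrow> real^'k^'k \<Rightarrow> real^'k^'k \<Rightarrow> real^'k \<Rightarrow> real^'k \<Rightarrow> nat \<Rightarrow> real^'k" where
  "gss_iterate \<omega> \<Theta> \<B> b u0 0 = u0"
| "gss_iterate \<omega> \<Theta> \<B> b u0 (Suc k) =
     G_GSS \<omega> \<Theta> \<B> *v gss_iterate \<omega> \<Theta> \<B> b u0 k + matrix_inv (P_GSS \<omega> \<Theta> \<B>) *v b"

end

theory Submission
  imports Defs
begin

text \<open>The quadratic form of \<open>\<Theta>\<^sup>-\<^sup>1\<B>\<close> vanishes on vectors \<open>(0, 0, z)\<close>, so
  \<open>\<lambda>\<^sub>m\<^sub>i\<^sub>n \<le> 0\<close> and the hypothesis forces \<open>\<omega> \<ge> 1/2\<close>.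
  For an error step \<open>e' = \<G> e\<close> put \<open>w = \<omega> e' + (1 - \<omega>) e\<close>, so that
  \<open>\<Theta> (e' - e) = - \<B> w\<close>. In the energy \<open>f x = x \<bullet> \<Theta> x\<close> this gives
  \<open>f e' = f e - 2 (w \<bullet> \<B> w) - (2 \<omega> - 1) f (e' - e) \<le> f e\<close>. The vectors \<open>w\<close> again form an orbit
  of \<open>\<G>\<close>, and two consecutive ones annihilate the form of \<open>\<B>\<close> only if they vanish. Hence
  two steps decrease \<open>f\<close> strictly, and by compactness of the sphere by a fixed factor.\<close>

section \<open>Quadratic forms\<close>

lemma inner_matrix_transpose:
  fixes X :: "real^'n^'m"
  shows "x \<bullet> (X *v y) = (transpose X *v x) \<bullet> y"
  by (simp add: dot_lmul_matrix)

lemma inner_sympart: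
  fixes X :: "real^'n^'n"
  shows "x \<bullet> (sympart X *v x) = x \<bullet> (X *v x)"
  unfolding sympart_def
  using inner_matrix_transpose[of x X x]
  by (simp add: scaleR_matrix_vector_assoc[symmetric] matrix_vector_mult_add_rdistrib
      inner_add_right inner_commute)

lemma invertible_if_kernel_trivial:
  fixes X :: "real^'n^'n"
  assumes "\<And>x. X *v x = 0 \<Longrightarrow> x = 0"
  shows "invertible X"
  using assms by (metis invertible_left_inverse matrix_left_invertible_ker)

lemma spd_nonneg: "spd X \<Longrightarrow> x \<bullet> (X *v x) \<ge> 0"
  unfolding spd_def by (cases "x = 0") (auto intro: less_imp_le)

lemma spd_kernel_trivial:
  assumes "spd X" "X *v x = 0"
  shows "x = 0"
  using assms unfolding spd_def by (metis inner_zero_right less_irrefl)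

lemma spd_invertible: "spd X \<Longrightarrow> invertible X"
  using invertible_if_kernel_trivial spd_kernel_trivial by blast

lemma matrix_inv_mult:
  assumes "invertible X"
  shows "X ** matrix_inv X = mat 1" and "matrix_inv X ** X = mat 1"
  using someI_ex[OF assms[unfolded invertible_def]] unfolding matrix_inv_def by blast+

lemma matrix_inv_mult_vector:
  fixes X :: "real^'n^'n"
  assumes "invertible X"
  shows "matrix_inv X *v (X *v x) = x" and "X *v (matrix_inv X *v x) = x"
  using matrix_inv_mult[OF assms] by (simp_all add: matrix_vector_mul_assoc)

lemma transpose_matrix_inv_symmetric:
  fixes X :: "real^'n^'n"
  assumes "invertible X" "transpose X = X"
  shows "transpose (matrix_inv X) = matrix_inv X"
proof -
  have "transpose (matrix_inv X) ** X = mat 1"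
    by (metis assms matrix_inv_mult(1) matrix_transpose_mul transpose_mat)
  then have "transpose (matrix_inv X) ** (X ** matrix_inv X) = matrix_inv X"
    by (simp add: matrix_mul_assoc)
  then show ?thesis
    by (simp add: matrix_inv_mult[OF assms(1)])
qed

section \<open>Quadratic forms and the compact unit sphere\<close>

lemma homogeneous_le_on_sphere:
  fixes f g :: "'a::real_normed_vector \<Rightarrow> real"
  assumes hom: "\<And>c x. f (c *\<^sub>R x) = c\<^sup>2 * f x" "\<And>c x. g (c *\<^sub>R x) = c\<^sup>2 * g x"
    and le: "\<And>x. norm x = 1 \<Longrightarrow> f x \<le> g x"
  shows "f x \<le> g x"
proof (cases "x = 0")
  case True
  then show ?thesis using hom[of 0 0] by simp
next
  case False
  have "f x = (norm x)\<^sup>2 * f (x /\<^sub>R norm x)" "g x = (norm x)\<^sup>2 * g (x /\<^sub>R norm x)"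
    unfolding hom using False by (simp_all add: power_inverse field_simps)
  then show ?thesis
    using le[of "x /\<^sub>R norm x"] False by (simp add: mult_left_mono)
qed

lemma quadratic_form_scaleR:
  fixes X :: "real^'n^'n"
  shows "(c *\<^sub>R x) \<bullet> (X *v (c *\<^sub>R x)) = c\<^sup>2 * (x \<bullet> (X *v x))"
  by (simp add: matrix_vector_mult_scaleR power2_eq_square)

lemma continuous_on_quadratic_form:
  fixes X :: "real^'n^'n"
  shows "continuous_on S (\<lambda>x. x \<bullet> (X *v x))"
  by (intro continuous_intros linear_continuous_on matrix_vector_mul_bounded_linear)

lemma unit_sphere_nonempty: "sphere (0 :: 'a::euclidean_space) 1 \<noteq> {}"
  by (metis SOME_Basis norm_Basis dist_0_norm mem_sphere empty_iff)

lemma quadratic_form_lower_bound: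
  fixes X :: "real^'n^'n"
  assumes "\<And>x. norm x = 1 \<Longrightarrow> c \<le> x \<bullet> (X *v x)"
  shows "c * (norm x)\<^sup>2 \<le> x \<bullet> (X *v x)"
proof (rule homogeneous_le_on_sphere[where f = "\<lambda>x. c * (norm x)\<^sup>2"])
  show "(a *\<^sub>R y) \<bullet> (X *v (a *\<^sub>R y)) = a\<^sup>2 * (y \<bullet> (X *v y))" for a y
    by (rule quadratic_form_scaleR)
qed (simp_all add: power_mult_distrib assms)

text \<open>The minimum over the unit sphere is attained, hence positive, and scaling carries it to
  all vectors. It later turns decay of the energy into decay of the norm.\<close>

lemma spd_coercive:
  assumes "spd X"
  obtains c where "c > 0" "\<And>x. c * (norm x)\<^sup>2 \<le> x \<bullet> (X *v x)"
proof -
  obtain v where v: "norm v = 1" "\<And>x. norm x = 1 \<Longrightarrow> v \<bullet> (X *v v) \<le> x \<bullet> (X *v x)"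
    using continuous_attains_inf[OF compact_sphere unit_sphere_nonempty continuous_on_quadratic_form[of _ X]]
    by auto
  have "v \<bullet> (X *v v) > 0"
    using assms v(1) unfolding spd_def by (metis norm_zero zero_neq_one)
  moreover have "v \<bullet> (X *v v) * (norm x)\<^sup>2 \<le> x \<bullet> (X *v x)" for x
    using v(2) by (rule quadratic_form_lower_bound)
  ultimately show thesis by (rule that)
qed

section \<open>Rayleigh quotients and the smallest eigenvalue of a symmetric matrix\<close>

lemma symmetric_eigenvalue_le_rayleigh:
  fixes S :: "real^'n^'n"
  assumes sym: "transpose S = S"
  obtains c where "is_eigenvalue S c" "\<And>x. c * (norm x)\<^sup>2 \<le> x \<bullet> (S *v x)"
proof -
  obtain v where v: "norm v = 1" "\<And>x. norm x = 1 \<Longrightarrow> v \<bullet> (S *v v) \<le> x \<bullet> (S *v x)"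
    using continuous_attains_inf[OF compact_sphere unit_sphere_nonempty continuous_on_quadratic_form[of _ S]]
    by auto
  define c where "c = v \<bullet> (S *v v)"
  have low: "c * (norm x)\<^sup>2 \<le> x \<bullet> (S *v x)" for x
    using v(2) unfolding c_def by (rule quadratic_form_lower_bound)
  \<comment> \<open>The minimizer \<open>v\<close> is shown to be an eigenvector by moving it along
    its own residual \<open>r\<close>: unless \<open>r = 0\<close>, a short move to
    \<open>v - t *\<^sub>R r\<close> would violate the lower bound \<open>low\<close>.\<close>
  define r where "r = S *v v - c *\<^sub>R v"
  define g where "g = r \<bullet> (S *v r) - c * (r \<bullet> r)"
  \<comment> \<open>The perturbed bound reads
    \<open>0 \<le> t\<^sup>2 * g - 2 * t * (r \<bullet> r)\<close>. This \<open>t\<close> turns its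
    right side into \<open>- (g + 2) * t\<^sup>2\<close>; the summand 1 keeps the denominator
    positive even if \<open>g = 0\<close>.\<close>
  define t where "t = (r \<bullet> r) / (g + 1)"
  have g: "g \<ge> 0"
    using low[of r] by (simp add: g_def power2_norm_eq_inner)
  have rt: "r \<bullet> r = t * (g + 1)"
    using g by (simp add: t_def)
  have vv: "v \<bullet> v = 1"
    using v(1) by (simp add: dot_square_norm)
  have swap: "v \<bullet> (S *v r) = r \<bullet> (S *v v)"
    by (metis inner_commute inner_matrix_transpose sym)
  have rr: "r \<bullet> (S *v v) = r \<bullet> r + c * (r \<bullet> v)"
    by (simp add: r_def inner_diff_right inner_diff_left inner_commute algebra_simps)
  have "0 \<le> (v - t *\<^sub>R r) \<bullet> (S *v (v - t *\<^sub>R r)) - c * ((v - t *\<^sub>R r) \<bullet> (v - t *\<^sub>R r))"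
    using low[of "v - t *\<^sub>R r"] by (simp add: power2_norm_eq_inner)
  also have "\<dots> = t\<^sup>2 * g - 2 * t * (r \<bullet> r)"
    using vv swap rr
    by (simp add: g_def c_def[symmetric] matrix_vector_mult_diff_distrib matrix_vector_mult_scaleR
        inner_diff_left inner_diff_right inner_commute[of v r] power2_eq_square algebra_simps)
  also have "\<dots> = t\<^sup>2 * (g - 2 * (g + 1))"
    by (simp add: rt power2_eq_square algebra_simps)
  finally have "t\<^sup>2 * (g + 2) \<le> 0"
    by (simp add: algebra_simps)
  then have "t = 0"
    using g by (simp add: mult_le_0_iff)
  then have "r = 0"
    using g by (simp add: t_def)
  then have "S *v v = c *s v"
    by (simp add: r_def scalar_mult_eq_scaleR)
  then have "is_eigenvalue S c"
    using v(1) unfolding is_eigenvalue_def by (metis norm_zero zero_neq_one)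
  then show thesis using low by (rule that)
qed

text \<open>Eigenvectors of distinct eigenvalues are orthogonal, and a pairwise orthogonal set is
  finite. Finiteness is what gives the \<open>Min\<close> in \<open>lambda_min\<close> its
  meaning.\<close>

lemma finite_eigenvalues_symmetric:
  fixes S :: "real^'n^'n"
  assumes sym: "transpose S = S"
  shows "finite {c. is_eigenvalue S c}"
proof -
  have "\<forall>c. \<exists>v. is_eigenvalue S c \<longrightarrow> v \<noteq> 0 \<and> S *v v = c *s v"
    unfolding is_eigenvalue_def by blast
  then obtain v where v: "\<And>c. is_eigenvalue S c \<Longrightarrow> v c \<noteq> 0 \<and> S *v v c = c *s v c"
    by metis
  let ?E = "{c. is_eigenvalue S c}"
  have orth: "v a \<bullet> v b = 0" if "a \<in> ?E" "b \<in> ?E" "a \<noteq> b" for a b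
  proof -
    have "v a \<bullet> (S *v v b) = (S *v v a) \<bullet> v b"
      by (metis inner_matrix_transpose sym)
    then have "b * (v a \<bullet> v b) = a * (v a \<bullet> v b)"
      using v that by (simp add: scalar_mult_eq_scaleR)
    then show ?thesis using that by simp
  qed
  \<comment> \<open>A vector chosen for two distinct eigenvalues would be orthogonal to itself,
    hence zero.\<close>
  have "inj_on v ?E"
    using orth v by (metis (no_types, lifting) inj_onI inner_eq_zero_iff mem_Collect_eq)
  moreover have "finite (v ` ?E)"
    using orth by (intro pairwise_orthogonal_imp_finite) (auto simp: pairwise_def orthogonal_def)
  ultimately show ?thesis
    using finite_imageD by blast
qed

lemma lambda_min_le_zero:
  fixes S :: "real^'n^'n"
  assumes sym: "transpose S = S" and x: "x \<noteq> 0" "x \<bullet> (S *v x) \<le> 0"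
  shows "lambda_min S \<le> 0"
proof -
  obtain c where c: "is_eigenvalue S c" "\<And>x. c * (norm x)\<^sup>2 \<le> x \<bullet> (S *v x)"
    using symmetric_eigenvalue_le_rayleigh[OF sym] by blast
  have "c * (norm x)\<^sup>2 \<le> 0"
    using c(2)[of x] x(2) by linarith
  then have "c \<le> 0"
    using x(1) by (simp add: mult_le_0_iff)
  moreover have "lambda_min S \<le> c"
    unfolding lambda_min_def using finite_eigenvalues_symmetric[OF sym] c(1) by (intro Min_le) auto
  ultimately show ?thesis by linarith
qed

section \<open>Contraction in the energy norm\<close>

text \<open>The form of \<open>K\<close> is only semidefinite, so \<open>no_isotropic_step\<close>
  supplies the missing strictness. Its equation is the one that \<open>step\<close> yields for
  \<open>w' = G *v w\<close>, written without an inverse so that it can be checked block by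
  block.\<close>

locale gss =
  fixes K T :: "real^'k^'k" and \<omega> :: real
  assumes spd: "spd T" and nonneg: "\<And>x. x \<bullet> (K *v x) \<ge> 0" and omega: "\<omega> \<ge> 1/2"
    and no_isotropic_step: "\<And>w w'. w \<bullet> (K *v w) = 0 \<Longrightarrow> w' \<bullet> (K *v w') = 0 \<Longrightarrow>
      T *v (w' - w) = - (K *v (\<omega> *\<^sub>R w' + (1 - \<omega>) *\<^sub>R w)) \<Longrightarrow> w = 0"
begin

abbreviation G where "G \<equiv> G_GSS \<omega> T K"

definition energy :: "real^'k \<Rightarrow> real" where "energy x = x \<bullet> (T *v x)"

lemma P_invertible: "invertible (P_GSS \<omega> T K)"
proof (rule invertible_if_kernel_trivial)
  fix x assume "P_GSS \<omega> T K *v x = 0"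
  then have "x \<bullet> (T *v x) + \<omega> * (x \<bullet> (K *v x)) = 0"
    unfolding P_GSS_def
    by (metis inner_add_right inner_scaleR_right inner_zero_right matrix_vector_mult_add_rdistrib
        scaleR_matrix_vector_assoc)
  moreover have "\<omega> * (x \<bullet> (K *v x)) \<ge> 0"
    using nonneg omega by simp
  ultimately have "x \<bullet> (T *v x) \<le> 0" by linarith
  then show "x = 0"
    using spd unfolding spd_def by (meson not_le)
qed

text \<open>Rearranging \<open>P_GSS\<close> applied to \<open>G *v e\<close> against
  \<open>N_GSS\<close> applied to \<open>e\<close> shows that the increment is driven by
  \<open>K\<close> at a weighted mean of the old and the new error.\<close>

lemma step: "T *v (G *v e - e) = - (K *v (\<omega> *\<^sub>R (G *v e) + (1 - \<omega>) *\<^sub>R e))"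
proof -
  have "P_GSS \<omega> T K *v (G *v e) = N_GSS \<omega> T K *v e"
    by (simp add: G_GSS_def matrix_vector_mul_assoc[symmetric] matrix_inv_mult_vector(2)[OF P_invertible])
  then show ?thesis
    by (simp add: P_GSS_def N_GSS_def matrix_vector_mult_add_rdistrib matrix_vector_mult_diff_rdistrib
        scaleR_matrix_vector_assoc[symmetric] matrix_vector_right_distrib matrix_vector_mult_diff_distrib
        matrix_vector_mult_scaleR algebra_simps)
qed

lemma energy_nonneg: "energy x \<ge> 0"
  using spd_nonneg[OF spd] by (simp add: energy_def)

lemma energy_step:
  assumes "w = \<omega> *\<^sub>R (G *v e) + (1 - \<omega>) *\<^sub>R e"
  shows "energy (G *v e) \<le> energy e - 2 * (w \<bullet> (K *v w))"
proof -
  define d where "d = G *v e - e"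
  have Ge: "G *v e = e + d" and w: "w = e + \<omega> *\<^sub>R d"
    by (simp_all add: d_def assms algebra_simps)
  have sym: "e \<bullet> (T *v d) = d \<bullet> (T *v e)"
    using spd unfolding spd_def by (metis inner_commute inner_matrix_transpose)
  have "w \<bullet> (T *v d) = - (w \<bullet> (K *v w))"
    using step[of e] assms by (simp add: d_def)
  then have "e \<bullet> (T *v d) = - (w \<bullet> (K *v w)) - \<omega> * energy d"
    by (simp add: w inner_add_left energy_def)
  \<comment> \<open>By symmetry of \<open>T\<close>, the energy of \<open>e + d\<close> is that of
    \<open>e\<close> plus \<open>2 * (e \<bullet> (T *v d))\<close> plus that of \<open>d\<close>;
    inserting the previous line leaves \<open>energy d\<close> with coefficient
    \<open>1 - 2 * \<omega>\<close>.\<close>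
  then have "energy (G *v e) = energy e - 2 * (w \<bullet> (K *v w)) - (2 * \<omega> - 1) * energy d"
    using sym by (simp add: Ge energy_def matrix_vector_right_distrib inner_add_left inner_add_right
        algebra_simps)
  moreover have "(2 * \<omega> - 1) * energy d \<ge> 0"
    using omega energy_nonneg by simp
  ultimately show ?thesis by linarith
qed

lemma energy_decreasing: "energy (G *v e) \<le> energy e"
  using energy_step[OF refl, of e] nonneg by (smt (verit))

text \<open>One application of \<open>energy_step\<close> gives no strict decrease when its
  \<open>w\<close> is isotropic for \<open>K\<close>, so a second step is taken into
  account.\<close>

lemma energy_two_steps_strict:
  assumes "e \<noteq> 0"
  shows "energy (G *v (G *v e)) < energy e"
proof (rule ccontr)
  assume not_less: "\<not> ?thesis"
  define w where "w = \<omega> *\<^sub>R (G *v e) + (1 - \<omega>) *\<^sub>R e"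
  \<comment> \<open>By linearity the weighted mean belonging to the second step is
    \<open>G *v w\<close>, so \<open>no_isotropic_step\<close> can be applied to the pair
    \<open>w\<close>, \<open>G *v w\<close>.\<close>
  have Gw: "G *v w = \<omega> *\<^sub>R (G *v (G *v e)) + (1 - \<omega>) *\<^sub>R (G *v e)"
    by (simp add: w_def matrix_vector_right_distrib matrix_vector_mult_scaleR)
  \<comment> \<open>Both losses are nonnegative; without a net decrease over the two steps both must
    vanish.\<close>
  have "w \<bullet> (K *v w) = 0" "(G *v w) \<bullet> (K *v (G *v w)) = 0"
    using energy_step[OF w_def] energy_step[OF Gw] nonneg[of w] nonneg[of "G *v w"] not_less
    by linarith+
  then have w0: "w = 0"
    using no_isotropic_step step by blast
  then have "T *v (G *v e - e) = 0"
    using step[of e] by (simp add: w_def)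
  then have "G *v e = e"
    using spd_kernel_trivial[OF spd] by fastforce
  then show False
    using w0 assms by (simp add: w_def algebra_simps)
qed

lemma energy_contraction:
  obtains q where "0 \<le> q" "q < 1" "\<And>e. energy (G *v (G *v e)) \<le> q * energy e"
proof -
  have pos: "energy x > 0" if "norm x = 1" for x
    using that spd unfolding spd_def energy_def by (metis norm_zero zero_neq_one)
  have cont: "continuous_on S energy" for S
    unfolding energy_def by (rule continuous_on_quadratic_form)
  have "continuous_on S (\<lambda>x. energy (G *v (G *v x)))" for S
    unfolding matrix_vector_mul_assoc
    by (intro continuous_on_compose2[OF cont[of UNIV]] linear_continuous_on
        matrix_vector_mul_bounded_linear) auto
  then have "continuous_on (sphere 0 1) (\<lambda>x. energy (G *v (G *v x)) / energy x)"
    using pos by (intro continuous_on_divide cont) force+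
  from continuous_attains_sup[OF compact_sphere unit_sphere_nonempty this]
  obtain v where v: "norm v = 1" "\<And>x. norm x = 1 \<Longrightarrow>
      energy (G *v (G *v x)) / energy x \<le> energy (G *v (G *v v)) / energy v"
    by auto
  \<comment> \<open>The factor is an attained maximum over the sphere, so the strict decrease at the
    maximizer \<open>v\<close> yields \<open>q < 1\<close>, not merely
    \<open>q \<le> 1\<close>.\<close>
  define q where "q = energy (G *v (G *v v)) / energy v"
  have "0 \<le> q"
    by (simp add: q_def energy_nonneg)
  moreover have "v \<noteq> 0"
    using v(1) by auto
  then have "q < 1"
    using energy_two_steps_strict[of v] pos[OF v(1)] by (simp add: q_def)
  moreover have "energy (G *v (G *v e)) \<le> q * energy e" for e
  proof (rule homogeneous_le_on_sphere[where x = e])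
    fix x :: "real^'k" assume "norm x = 1"
    then show "energy (G *v (G *v x)) \<le> q * energy x"
      using v(2)[of x] pos[of x] by (simp add: q_def[symmetric] pos_divide_le_eq)
  qed (simp_all add: energy_def quadratic_form_scaleR matrix_vector_mult_scaleR power2_eq_square)
  ultimately show thesis by (rule that)
qed

section \<open>Convergence of the errors and of the iteration\<close>

lemma orbit_tendsto_zero:
  assumes e: "\<And>k. e (Suc k) = G *v e k"
  shows "e \<longlonglongrightarrow> 0"
proof -
  obtain q where q: "0 \<le> q" "q < 1" "\<And>e. energy (G *v (G *v e)) \<le> q * energy e"
    using energy_contraction by blast
  obtain c where c: "c > 0" "\<And>x. c * (norm x)\<^sup>2 \<le> energy x"
    using spd_coercive[OF spd] unfolding energy_def by blast
  have even: "energy (e (2 * k)) \<le> q ^ k * energy (e 0)" for k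
  proof (induction k)
    case (Suc k)
    have "energy (e (2 * Suc k)) \<le> q * energy (e (2 * k))"
      using q(3) e by simp
    also have "\<dots> \<le> q * (q ^ k * energy (e 0))"
      using Suc q(1) by (rule mult_left_mono)
    finally show ?case by simp
  qed simp
  \<comment> \<open>The factor is gained once per pair of steps. An odd index is compared with its
    predecessor by monotonicity, hence the exponent \<open>k div 2\<close>.\<close>
  have "energy (e k) \<le> q ^ (k div 2) * energy (e 0)" for k
  proof (cases "even k")
    case True
    then show ?thesis using even[of "k div 2"] by simp
  next
    case False
    then have "energy (e k) \<le> energy (e (2 * (k div 2)))"
      using energy_decreasing e by (metis odd_two_times_div_two_succ Suc_eq_plus1)
    then show ?thesis using even[of "k div 2"] by linarith
  qed
  then have bound: "(norm (e k))\<^sup>2 \<le> q ^ (k div 2) * (energy (e 0) / c)" for k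
    using c(2)[of "e k"] c(1) by (smt (verit) mult.commute pos_le_divide_eq times_divide_eq_right)
  have "filterlim (\<lambda>k::nat. k div 2) sequentially sequentially"
    by (intro filterlim_at_top_div_const_nat) simp
  then have "(\<lambda>k. q ^ (k div 2)) \<longlonglongrightarrow> 0"
    using LIMSEQ_realpow_zero[OF q(1,2)] by (rule filterlim_compose[rotated])
  then have "(\<lambda>k. q ^ (k div 2) * (energy (e 0) / c)) \<longlonglongrightarrow> 0"
    by (rule tendsto_mult_left_zero)
  then have "(\<lambda>k. (norm (e k))\<^sup>2) \<longlonglongrightarrow> 0"
    by (rule Lim_null_comparison[rotated]) (use bound in simp)
  then have "(\<lambda>k. norm (e k)) \<longlonglongrightarrow> 0"
    by (simp add: power_tendsto_0_iff)
  then show ?thesis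
    by (rule tendsto_norm_zero_cancel)
qed

lemma gss_iterate_tendsto:
  assumes u: "K *v u = b"
  shows "gss_iterate \<omega> T K b u0 \<longlonglongrightarrow> u"
proof -
  \<comment> \<open>Since \<open>P_GSS - N_GSS = K\<close>, a solution is a fixed point of the
    iteration, and the error follows the homogeneous recursion.\<close>
  have "P_GSS \<omega> T K *v u = N_GSS \<omega> T K *v u + b"
    by (simp add: u[symmetric] P_GSS_def N_GSS_def matrix_vector_mult_add_rdistrib
        matrix_vector_mult_diff_rdistrib scaleR_matrix_vector_assoc[symmetric] algebra_simps)
  then have "u = G *v u + matrix_inv (P_GSS \<omega> T K) *v b"
    using matrix_inv_mult_vector(1)[OF P_invertible, of u]
    by (simp add: G_GSS_def matrix_vector_mul_assoc[symmetric] matrix_vector_right_distrib)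
  then have "gss_iterate \<omega> T K b u0 (Suc k) - u = G *v (gss_iterate \<omega> T K b u0 k - u)" for k
    by (simp add: matrix_vector_mult_diff_distrib algebra_simps)
  then show ?thesis
    using orbit_tendsto_zero[of "\<lambda>k. gss_iterate \<omega> T K b u0 k - u"] by (simp add: LIM_zero_iff)
qed

end

section \<open>Block vectors\<close>

text \<open>The nesting of \<open>Inl\<close> and \<open>Inr\<close> matches
  \<open>block_matrix3\<close>, so matrix equations split into one equation per block row.\<close>

definition join3 :: "'a^'n \<Rightarrow> 'a^'l \<Rightarrow> 'a^'m \<Rightarrow> 'a^('n + 'l + 'm)" where
  "join3 x y z = (\<chi> i. case i of Inl p \<Rightarrow> x $ p | Inr (Inl p) \<Rightarrow> y $ p | Inr (Inr p) \<Rightarrow> z $ p)"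

lemma sum_UNIV_Plus:
  fixes f :: "'a::finite + 'b::finite \<Rightarrow> 'c::comm_monoid_add"
  shows "sum f UNIV = (\<Sum>i\<in>UNIV. f (Inl i)) + (\<Sum>i\<in>UNIV. f (Inr i))"
  by (simp add: UNIV_Plus_UNIV[symmetric] sum.Plus del: UNIV_Plus_UNIV)

lemma join3_exhaust:
  obtains x y z where "v = join3 x y z"
proof
  show "v = join3 (\<chi> i. v $ Inl i) (\<chi> i. v $ Inr (Inl i)) (\<chi> i. v $ Inr (Inr i))"
    by (simp add: join3_def vec_eq_iff split: sum.split)
qed

lemma join3_nth [simp]:
  "join3 x y z $ Inl i = x $ i"
  "join3 x y z $ Inr (Inl j) = y $ j"
  "join3 x y z $ Inr (Inr k) = z $ k"
  by (simp_all add: join3_def)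

lemma join3_eq_iff: "join3 x y z = join3 x' y' z' \<longleftrightarrow> x = x' \<and> y = y' \<and> z = z'"
  by (metis join3_nth vec_eq_iff)

lemma join3_zero: "join3 0 0 0 = 0"
  by (simp add: join3_def vec_eq_iff split: sum.split)

lemma join3_eq_0_iff: "join3 x y z = 0 \<longleftrightarrow> x = 0 \<and> y = 0 \<and> z = 0"
  using join3_eq_iff[of x y z 0 0 0] by (simp add: join3_zero)

lemma join3_add: "join3 x y z + join3 x' y' z' = join3 (x + x') (y + y') (z + z')"
  and join3_diff: "join3 a b c - join3 a' b' c' = join3 (a - a') (b - b') (c - c')"
  and join3_uminus: "- join3 a b c = join3 (- a) (- b) (- c)"
  and join3_scaleR: "r *\<^sub>R join3 s t u = join3 (r *\<^sub>R s) (r *\<^sub>R t) (r *\<^sub>R u)"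
  by (simp_all add: join3_def vec_eq_iff split: sum.split)

lemma inner_join3: "join3 x y z \<bullet> join3 x' y' z' = x \<bullet> x' + y \<bullet> y' + z \<bullet> z'"
  by (simp add: inner_vec_def sum_UNIV_Plus join3_def add.assoc)

section \<open>Block matrices acting on block vectors\<close>

lemma block_matrix3_mult_join3:
  "block_matrix3 X11 X12 X13 X21 X22 X23 X31 X32 X33 *v join3 x y z =
   join3 (X11 *v x + X12 *v y + X13 *v z) (X21 *v x + X22 *v y + X23 *v z) (X31 *v x + X32 *v y + X33 *v z)"
  by (simp add: vec_eq_iff matrix_vector_mult_def sum_UNIV_Plus join3_def block_matrix3_def add.assoc
      split: sum.split)

lemma matrix_vector_mult_uminus:
  fixes X :: "real^'n^'m"
  shows "(- X) *v x = - (X *v x)"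
  by (simp add: vec_eq_iff matrix_vector_mult_def sum_negf)

lemma saddle_mult_join3:
  "saddle_matrix A B C D *v join3 x y z =
   join3 (A *v x + transpose B *v z) (D *v y + C *v z) (- (B *v x) - transpose C *v y)"
  by (simp add: saddle_matrix_def block_matrix3_mult_join3 matrix_vector_mult_uminus)

lemma Theta_mult_join3:
  "Theta_matrix \<alpha> \<beta> \<tau> P Q R *v join3 x y z =
   join3 (\<alpha> *\<^sub>R (P *v x)) (\<beta> *\<^sub>R (Q *v y)) (\<tau> *\<^sub>R (R *v z))"
  by (simp add: Theta_matrix_def block_matrix3_mult_join3 scaleR_matrix_vector_assoc)

text \<open>The off-diagonal blocks are skew, so their contributions cancel and \<open>z\<close>
  drops out.\<close>

lemma saddle_quadratic_form:
  "join3 x y z \<bullet> (saddle_matrix A B C D *v join3 x y z) = x \<bullet> (A *v x) + y \<bullet> (D *v y)"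
  using inner_matrix_transpose[of z B x] inner_matrix_transpose[of y C z]
  by (simp add: saddle_mult_join3 inner_join3 inner_add_right inner_diff_right inner_commute)

lemma transpose_Theta:
  assumes "transpose P = P" "transpose Q = Q" "transpose R = R"
  shows "transpose (Theta_matrix \<alpha> \<beta> \<tau> P Q R) = Theta_matrix \<alpha> \<beta> \<tau> P Q R"
proof -
  have "P $ j $ i = P $ i $ j" "Q $ k $ l = Q $ l $ k" "R $ p $ q = R $ q $ p" for i j k l p q
    by (metis assms(1) transpose_def vec_lambda_beta, metis assms(2) transpose_def vec_lambda_beta,
        metis assms(3) transpose_def vec_lambda_beta)
  then show ?thesis
    by (simp add: Theta_matrix_def block_matrix3_def transpose_def vec_eq_iff split: sum.split)
qed

lemma spd_Theta:
  assumes "spd P" "spd Q" "spd R" "\<alpha> > 0" "\<beta> > 0" "\<tau> > 0"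
  shows "spd (Theta_matrix \<alpha> \<beta> \<tau> P Q R)"
proof -
  have "0 < v \<bullet> (Theta_matrix \<alpha> \<beta> \<tau> P Q R *v v)" if "v \<noteq> 0" for v
  proof -
    obtain x y z where v: "v = join3 x y z" by (rule join3_exhaust)
    have form: "v \<bullet> (Theta_matrix \<alpha> \<beta> \<tau> P Q R *v v) =
        \<alpha> * (x \<bullet> (P *v x)) + \<beta> * (y \<bullet> (Q *v y)) + \<tau> * (z \<bullet> (R *v z))"
      by (simp add: v Theta_mult_join3 inner_join3)
    have "0 \<le> \<alpha> * (x \<bullet> (P *v x))" "0 \<le> \<beta> * (y \<bullet> (Q *v y))" "0 \<le> \<tau> * (z \<bullet> (R *v z))"
      using assms by (auto intro!: mult_nonneg_nonneg spd_nonneg)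
    moreover have "x \<noteq> 0 \<or> y \<noteq> 0 \<or> z \<noteq> 0"
      using that by (auto simp: v join3_zero)
    then have "0 < \<alpha> * (x \<bullet> (P *v x)) \<or> 0 < \<beta> * (y \<bullet> (Q *v y)) \<or> 0 < \<tau> * (z \<bullet> (R *v z))"
      using assms by (auto simp: spd_def)
    ultimately show ?thesis
      unfolding form by linarith
  qed
  then show ?thesis
    using transpose_Theta[of P Q R] assms unfolding spd_def by blast
qed

section \<open>The symmetric part of the preconditioned matrix and the sign of its smallest
  eigenvalue\<close>

lemma transpose_Theta_tilde:
  fixes T K :: "real^'k^'k"
  assumes "invertible T" "transpose T = T"
  shows "transpose (Theta_tilde T K) = Theta_tilde T K"
proof -
  have "transpose (c *\<^sub>R (X + transpose X)) = c *\<^sub>R (X + transpose X)" for c and X :: "real^'k^'k"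
    by (simp add: transpose_def vec_eq_iff add.commute)
  from this[of "1/2" "matrix_inv T ** K"] show ?thesis
    by (simp add: Theta_tilde_def matrix_transpose_mul transpose_matrix_inv_symmetric[OF assms])
qed

text \<open>\<open>Theta_tilde\<close> is the symmetric part of \<open>matrix_inv T ** K\<close>, so
  both have the same form; the symmetric inverse then moves to the left argument.\<close>

lemma Theta_tilde_quadratic_form:
  fixes T K :: "real^'k^'k"
  assumes "invertible T" "transpose T = T"
  shows "x \<bullet> (Theta_tilde T K *v x) = (matrix_inv T *v x) \<bullet> (K *v x)"
proof -
  have "Theta_tilde T K = sympart (matrix_inv T ** K)"
    by (simp add: Theta_tilde_def sympart_def matrix_transpose_mul transpose_matrix_inv_symmetric[OF assms])
  then show ?thesis
    using inner_matrix_transpose[of x "matrix_inv T" "K *v x"]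
    by (simp add: inner_sympart matrix_vector_mul_assoc[symmetric] transpose_matrix_inv_symmetric[OF assms])
qed

lemma lambda_min_Theta_tilde_saddle:
  fixes A P :: "real^'n^'n" and D Q :: "real^'l^'l" and R :: "real^'m^'m"
    and B :: "real^'n^'m" and C :: "real^'m^'l"
  assumes "spd P" "spd Q" "spd R" "\<alpha> > 0" "\<beta> > 0" "\<tau> > 0"
  shows "lambda_min (Theta_tilde (Theta_matrix \<alpha> \<beta> \<tau> P Q R) (saddle_matrix A B C D)) \<le> 0"
proof -
  let ?T = "Theta_matrix \<alpha> \<beta> \<tau> P Q R"
  let ?K = "saddle_matrix A B C D"
  have T: "invertible ?T" "transpose ?T = ?T"
    using spd_Theta[OF assms] by (simp_all add: spd_invertible) (simp add: spd_def)
  define z :: "real^'m" where "z = 1"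
  \<comment> \<open>As the image of \<open>join3 0 0 z\<close> under \<open>?T\<close>, this vector
    has a known preimage. The zero last diagonal block of the saddle matrix makes the form vanish at
    it.\<close>
  define v where "v = join3 (0::real^'n) (0::real^'l) (\<tau> *\<^sub>R (R *v z))"
  have "z \<noteq> 0"
    by (simp add: z_def vec_eq_iff)
  then have "v \<noteq> 0"
    using assms spd_kernel_trivial[of R z] by (auto simp: v_def join3_eq_0_iff)
  have "?T *v join3 0 0 z = v"
    by (simp add: v_def Theta_mult_join3)
  then have "matrix_inv ?T *v v = join3 0 0 z"
    using matrix_inv_mult_vector(1)[OF T(1)] by metis
  then have "v \<bullet> (Theta_tilde ?T ?K *v v) = 0"
    by (simp add: Theta_tilde_quadratic_form[OF T]) (simp add: v_def saddle_mult_join3 inner_join3)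
  then show ?thesis
    using lambda_min_le_zero[OF transpose_Theta_tilde[OF T] \<open>v \<noteq> 0\<close>] by simp
qed

section \<open>Convergence for the saddle point system\<close>

theorem theorem4p1:
  fixes A P :: "real^'n^'n" and D Q :: "real^'l^'l" and R :: "real^'m^'m"
    and B :: "real^'n^'m" and C :: "real^'m^'l"
    and \<alpha> \<beta> \<tau> \<omega> :: real
    and \<B> \<Theta> :: "real^('n + 'l + 'm)^('n + 'l + 'm)"
  assumes "CARD('n) \<ge> CARD('m)" and "CARD('m) \<ge> CARD('l)"
    and "invertible A" and "invertible D"
    and "spd (sympart A)" and "spd (sympart D)"
    and "rank B = CARD('m)" and "rank C = CARD('l)"
    and "\<alpha> > 0" and "\<beta> > 0" and "\<tau> > 0" and "\<omega> > 0"
    and "spd P" and "spd Q" and "spd R"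
    and "\<B> = saddle_matrix A B C D"
    and "\<Theta> = Theta_matrix \<alpha> \<beta> \<tau> P Q R"
    and "\<omega> \<ge> max (1/2 - lambda_min (Theta_tilde \<Theta> \<B>) / (spectral_radius (matrix_inv \<Theta> ** \<B>))\<^sup>2) 0"
  shows "invertible (P_GSS \<omega> \<Theta> \<B>) \<and>
    (\<forall>b. \<exists>u. (\<forall>v. \<B> *v v = b \<longleftrightarrow> v = u) \<and>
             (\<forall>u0. (\<lambda>k. gss_iterate \<omega> \<Theta> \<B> b u0 k) \<longlonglongrightarrow> u))"
proof -
  have "lambda_min (Theta_tilde \<Theta> \<B>) \<le> 0"
    unfolding assms(16,17) by (rule lambda_min_Theta_tilde_saddle) (use assms in blast)+
  \<comment> \<open>The denominator is a square; the convention \<open>x / 0 = 0\<close> covers a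
    zero spectral radius.\<close>
  then have "lambda_min (Theta_tilde \<Theta> \<B>) / (spectral_radius (matrix_inv \<Theta> ** \<B>))\<^sup>2 \<le> 0"
    by (simp add: divide_nonpos_nonneg)
  then have omega: "\<omega> \<ge> 1/2"
    using assms(18) by linarith
  have A: "x \<noteq> 0 \<Longrightarrow> x \<bullet> (A *v x) > 0" and D: "y \<noteq> 0 \<Longrightarrow> y \<bullet> (D *v y) > 0" for x y
    using assms(5,6) unfolding spd_def inner_sympart by auto
  have A0: "x \<bullet> (A *v x) \<ge> 0" and D0: "y \<bullet> (D *v y) \<ge> 0" for x y
    using A[of x] D[of y] by fastforce+
  \<comment> \<open>Full row rank of \<open>B\<close> makes its transpose injective, which controls
    the third block that the form of \<B> does not see.\<close>
  have "inj ((*v) (transpose B))"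
    using assms(7) by (simp add: full_rank_injective[symmetric] rank_transpose)
  then have B: "z = 0" if "transpose B *v z = 0" for z
    using that by (metis injD matrix_vector_mult_0_right)
  have isotropic: "x = 0 \<and> y = 0" if "join3 x y z \<bullet> (\<B> *v join3 x y z) = 0" for x y z
    using that A[of x] D[of y] A0[of x] D0[of y] unfolding assms(16) saddle_quadratic_form
    by fastforce
  have "invertible \<B>"
  proof (rule invertible_if_kernel_trivial)
    fix v assume v: "\<B> *v v = 0"
    obtain x y z where v_eq: "v = join3 x y z" by (rule join3_exhaust)
    \<comment> \<open>A kernel vector annihilates the form, which removes \<open>x\<close> and
      \<open>y\<close>; the first block row then reads \<open>transpose B *v z = 0\<close>.\<close>
    have xy: "x = 0" "y = 0"
      using v isotropic[of x y z] by (simp_all add: v_eq)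
    then have "z = 0"
      using v B by (simp add: v_eq assms(16) saddle_mult_join3 join3_eq_0_iff)
    then show "v = 0"
      using xy by (simp add: v_eq join3_zero)
  qed
  interpret gss \<B> \<Theta> \<omega>
  proof
    show "spd \<Theta>"
      using spd_Theta assms by blast
    show "\<omega> \<ge> 1/2"
      by (rule omega)
    show "v \<bullet> (\<B> *v v) \<ge> 0" for v
      using A0 D0 by (cases v rule: join3_exhaust) (simp add: assms(16) saddle_quadratic_form)
    fix w w'
    assume iso: "w \<bullet> (\<B> *v w) = 0" "w' \<bullet> (\<B> *v w') = 0"
      and step: "\<Theta> *v (w' - w) = - (\<B> *v (\<omega> *\<^sub>R w' + (1 - \<omega>) *\<^sub>R w))"
    obtain z z' where w: "w = join3 0 0 z" "w' = join3 0 0 z'"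
      using iso isotropic by (metis join3_exhaust)
    \<comment> \<open>These are the first and third block rows of \<open>step\<close>. The third row
      of \<B> vanishes on vectors \<open>join3 0 0 z\<close>, which forces \<open>z' = z\<close>,
      and the weighted mean in the first row reduces to \<open>z\<close>.\<close>
    have "transpose B *v (\<omega> *\<^sub>R z' + (1 - \<omega>) *\<^sub>R z) = 0" "R *v (z' - z) = 0"
      using step assms(11)
      by (simp_all add: w assms(16,17) join3_add join3_diff join3_scaleR join3_uminus
          saddle_mult_join3 Theta_mult_join3 join3_eq_iff)
    then have "\<omega> *\<^sub>R z' + (1 - \<omega>) *\<^sub>R z = 0" "z' = z"
      using B spd_kernel_trivial[OF assms(15)] by force+
    then show "w = 0"
      by (simp add: w join3_eq_0_iff algebra_simps)
  qed
  have "\<exists>u. (\<forall>v. \<B> *v v = b \<longleftrightarrow> v = u) \<and> (\<forall>u0. gss_iterate \<omega> \<Theta> \<B> b u0 \<longlonglongrightarrow> u)" for b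
    using gss_iterate_tendsto matrix_inv_mult_vector[OF \<open>invertible \<B>\<close>] by metis
  then show ?thesis
    using P_invertible by blast
qed

end
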